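(* Let $Y$ be a compact Hausdorff space and let $E\subseteq Y$ be a Borel set. Then the evaluation function $\mathrm{ev}_E:\mathrm{ProbMeas}(Y)\to\mathbb{R}$, $\mu\mapsto\mu(E)$, is Borel measurable with respect to the vague topology on $\mathrm{ProbMeas}(Y)$. In fact, $\mathrm{ev}_E$ is lower semi-continuous when $E$ is open and upper semi-continuous when $E$ is closed.
   Context: $\mathrm{ProbMeas}(Y)$ is the set of regular Borel probability measures on $Y$ (outer regular by open sets and inner regular by compact sets on all Borel sets). The vague topology on it is the coarsest topology making $\mu\mapsto\int_Y\varphi\,d\mu$ continuous for every continuous $\varphi:Y\to\mathbb{C}$; equivalently a net $\mu_\theta$ converges to $\mu$ iff $\int_Y\varphi\,d\mu_\theta\to\int_Y\varphi\,d\mu$ for all $\varphi\in C(Y)$. A real function $g$ on a topological space is lower (resp. upper) semi-continuous iff $g^{-1}((a,\infty))$ (resp. $g^{-1}((-\infty,a))$) is open for all $a\in\mathbb{R}$. *)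

theory Defs
  imports "HOL-Probability.Probability_Measure"
begin

text \<open>The measurable space carried by an abstract topology; the library's \<open>borel\<close> is tied to the
  type class \<open>topological_space\<close>.\<close>

definition borel_of :: "'a topology \<Rightarrow> 'a measure" where
  "borel_of X = sigma (topspace X) {U. openin X U}"

definition regular_measure :: "'a topology \<Rightarrow> 'a measure \<Rightarrow> bool" where
  "regular_measure Y M \<longleftrightarrow>
     (\<forall>B\<in>sets (borel_of Y).
        emeasure M B = (INF U\<in>{U. openin Y U \<and> B \<subseteq> U}. emeasure M U) \<and>
        emeasure M B = (SUP K\<in>{K. compactin Y K \<and> K \<subseteq> B}. emeasure M K))"

definition ProbMeas :: "'a topology \<Rightarrow> 'a measure set" where
  "ProbMeas Y = {M. sets M = sets (borel_of Y) \<and> prob_space M \<and> regular_measure Y M}"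

definition vague_topology :: "'a topology \<Rightarrow> 'a measure topology" where
  "vague_topology Y = topology_generated_by
     {{M \<in> ProbMeas Y. (\<integral>x. \<phi> x \<partial>M) \<in> V} | (\<phi> :: 'a \<Rightarrow> complex) V.
        continuous_map Y euclidean \<phi> \<and> open V}"

definition ev :: "'a set \<Rightarrow> 'a measure \<Rightarrow> real" where
  "ev E M = measure M E"

definition lower_semicontinuous_map :: "'a topology \<Rightarrow> ('a \<Rightarrow> real) \<Rightarrow> bool" where
  "lower_semicontinuous_map X g \<longleftrightarrow> (\<forall>a. openin X {x \<in> topspace X. g x \<in> {a<..}})"

definition upper_semicontinuous_map :: "'a topology \<Rightarrow> ('a \<Rightarrow> real) \<Rightarrow> bool" where
  "upper_semicontinuous_map X g \<longleftrightarrow> (\<forall>a. openin X {x \<in> topspace X. g x \<in> {..<a}})"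

lemma sets_borel_of: "sets (borel_of X) = sigma_sets (topspace X) {U. openin X U}"
  unfolding borel_of_def by (rule sets_measure_of) (auto dest: openin_subset)

lemma space_borel_of [simp]: "space (borel_of X) = topspace X"
  unfolding borel_of_def by (rule space_measure_of) (auto dest: openin_subset)

lemma topspace_vague_topology [simp]: "topspace (vague_topology Y) = ProbMeas Y"
proof -
  have "ProbMeas Y \<in> {{M \<in> ProbMeas Y. (\<integral>x. \<phi> x \<partial>M) \<in> V} | (\<phi> :: 'a \<Rightarrow> complex) V.
          continuous_map Y euclidean \<phi> \<and> open V}"
    by (rule CollectI, rule exI[of _ "\<lambda>_. 0"], rule exI[of _ UNIV]) simp
  then show ?thesis
    unfolding vague_topology_def topology_generated_by_topspace by blast
qed

text \<open>The two defining properties of the coarsest topology on \<open>ProbMeas Y\<close> making integration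
  against every continuous function continuous.\<close>

lemma continuous_map_vague_integral:
  fixes \<phi> :: "'a \<Rightarrow> complex"
  assumes "continuous_map Y euclidean \<phi>"
  shows "continuous_map (vague_topology Y) euclidean (\<lambda>M. \<integral>x. \<phi> x \<partial>M)"
  unfolding continuous_map_def topspace_vague_topology
proof (intro conjI allI impI)
  fix V :: "complex set" assume "openin euclidean V"
  then show "openin (vague_topology Y) {M \<in> ProbMeas Y. (\<integral>x. \<phi> x \<partial>M) \<in> V}"
    unfolding vague_topology_def using assms
    by (intro topology_generated_by_Basis CollectI exI[of _ \<phi>] exI[of _ V]) simp
qed simp

lemma vague_topology_coarsest:
  assumes "topspace T = ProbMeas Y"
    and "\<And>\<phi> :: 'a \<Rightarrow> complex. continuous_map Y euclidean \<phi> \<Longrightarrow>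
           continuous_map T euclidean (\<lambda>M. \<integral>x. \<phi> x \<partial>M)"
    and "openin (vague_topology Y) W"
  shows "openin T W"
proof -
  have "generate_topology_on {{M \<in> ProbMeas Y. (\<integral>x. \<phi> x \<partial>M) \<in> V} | (\<phi> :: 'a \<Rightarrow> complex) V.
        continuous_map Y euclidean \<phi> \<and> open V} W"
    using assms(3) unfolding vague_topology_def by (rule openin_topology_generated_by)
  then show ?thesis
  proof induct
    case (Basis s)
    then obtain \<phi> :: "'a \<Rightarrow> complex" and V where s: "s = {M \<in> ProbMeas Y. (\<integral>x. \<phi> x \<partial>M) \<in> V}"
      and "continuous_map Y euclidean \<phi>" "open V" by blast
    then have "openin T {M \<in> topspace T. (\<integral>x. \<phi> x \<partial>M) \<in> V}"
      by (intro openin_continuous_map_preimage[OF assms(2)]) simp_all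
    then show ?case using s assms(1) by simp
  next
    case (UN K)
    then show ?case by (intro openin_Union)
  next
    case (Int a b)
    then show ?case by (intro openin_Int)
  qed simp
qed

end

theory Submission
  imports Defs
begin

text \<open>For open \<open>U\<close>, inner regularity and Urysohn's lemma give
  \<open>\<mu>(U) = sup {\<integral>f d\<mu> | f continuous, 0 \<le> f \<le> 1, f = 0 off U}\<close>, a supremum of continuous functions
  of \<open>\<mu>\<close>; this is lower semicontinuity. Complements handle closed sets, and Dynkin's
  \<open>\<pi>\<close>-\<open>\<lambda>\<close> theorem passes from the intersection-stable family of open sets to all Borel sets.\<close>

lemma sets_borel_of_openin: "openin X U \<Longrightarrow> U \<in> sets (borel_of X)"
  by (auto simp: sets_borel_of)

lemma sets_borel_of_closedin:
  assumes "closedin X C"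
  shows "C \<in> sets (borel_of X)"
proof -
  have "topspace X - (topspace X - C) \<in> sets (borel_of X)"
    using assms sets.compl_sets[of "topspace X - C" "borel_of X"]
    by (simp add: sets_borel_of_openin openin_diff)
  moreover have "topspace X - (topspace X - C) = C"
    using closedin_subset[OF assms] by blast
  ultimately show ?thesis by simp
qed

lemma continuous_map_borel_measurable:
  fixes f :: "'a \<Rightarrow> 'b::topological_space"
  assumes "continuous_map X euclidean f"
  shows "f \<in> borel_measurable (borel_of X)"
proof (rule borel_measurableI)
  fix S :: "'b set" assume "open S"
  then have "openin X {x \<in> topspace X. f x \<in> S}"
    by (intro openin_continuous_map_preimage[OF assms]) simp
  then show "f -` S \<inter> space (borel_of X) \<in> sets (borel_of X)"
    by (auto dest!: sets_borel_of_openin simp: vimage_def Int_def conj_commute)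
qed

text \<open>The open rays \<open>{a<..}\<close> generate the Borel sets of the real line, so open
  superlevel sets suffice.\<close>

lemma lower_semicontinuous_map_borel_measurable:
  assumes "lower_semicontinuous_map X g"
  shows "g \<in> borel_measurable (borel_of X)"
proof (rule borel_measurableI_greater)
  fix a
  show "{x \<in> space (borel_of X). a < g x} \<in> sets (borel_of X)"
    using assms by (auto simp: lower_semicontinuous_map_def intro: sets_borel_of_openin)
qed

lemma ProbMeasD:
  assumes "M \<in> ProbMeas Y"
  shows "prob_space M" "sets M = sets (borel_of Y)" "space M = topspace Y" "regular_measure Y M"
  using assms sets_eq_imp_space_eq[of M "borel_of Y"] by (auto simp: ProbMeas_def)

text \<open>The vague topology is given by complex test functions, whereas Urysohn functions are
  real. Embedding \<open>f\<close> into the complex numbers and taking \<open>Re\<close> of the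
  integral bridges the two.\<close>

lemma continuous_map_vague_integral_real:
  fixes f :: "'a \<Rightarrow> real"
  assumes "continuous_map Y euclidean f"
  shows "continuous_map (vague_topology Y) euclidean (\<lambda>M. \<integral>x. f x \<partial>M)"
proof -
  have "continuous_map Y euclidean (\<lambda>x. complex_of_real (f x))"
    using continuous_map_compose[OF assms, of euclidean complex_of_real]
    by (simp add: o_def continuous_intros)
  from continuous_map_compose[OF continuous_map_vague_integral[OF this], of euclidean Re]
  show ?thesis by (simp add: o_def continuous_intros)
qed

text \<open>Openness is checked point by point: for each \<open>N\<close> with
  \<open>N(U) > a\<close>, one compact set and one Urysohn function already yield a vague
  neighbourhood of \<open>N\<close> on which the mass of \<open>U\<close> stays above
  \<open>a\<close>.\<close>

lemma lower_semicontinuous_ev: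
  assumes "compact_space Y" "Hausdorff_space Y" "openin Y U"
  shows "lower_semicontinuous_map (vague_topology Y) (ev U)"
  unfolding lower_semicontinuous_map_def topspace_vague_topology
proof
  fix a :: real
  let ?S = "{M \<in> ProbMeas Y. ev U M \<in> {a<..}}"
  show "openin (vague_topology Y) ?S"
  proof (subst openin_subopen, rule ballI)
    fix N assume N: "N \<in> ?S"
    then interpret N: prob_space N using ProbMeasD by blast
    obtain K where K: "compactin Y K" "K \<subseteq> U" "a < measure N K"
    \<comment> \<open>Inner regularity is stated in \<open>ennreal\<close>, where a negative
      \<open>a\<close> would be truncated to 0 and strictness could fail. For such \<open>a\<close>
      the empty set serves as \<open>K\<close>; otherwise \<open>a\<close> lies below the supremum
      over compact subsets, so some \<open>K\<close> exceeds it.\<close>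
    proof (cases "a < 0")
      case True
      then show ?thesis using that[of "{}"] by simp
    next
      case False
      have "ennreal a < emeasure N U"
        using N False by (simp add: ev_def N.emeasure_eq_measure ennreal_less_iff)
      also have "\<dots> = (SUP K\<in>{K. compactin Y K \<and> K \<subseteq> U}. emeasure N K)"
        using N ProbMeasD(4)[of N Y] sets_borel_of_openin[OF assms(3)]
        by (auto simp: regular_measure_def)
      finally show ?thesis
        using that False by (auto simp: less_SUP_iff N.emeasure_eq_measure ennreal_less_iff)
    qed
    have closed: "closedin Y K"
      using K(1) assms(2) by (rule compactin_imp_closedin[rotated])
    have "normal_space Y"
      using assms compact_Hausdorff_or_regular_imp_normal_space by blast
    then obtain f where f: "continuous_map Y (top_of_set {0..1::real}) f"
      and f0: "f ` (topspace Y - U) \<subseteq> {0}" and f1: "f ` K \<subseteq> {1}"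
      by (rule Urysohn_lemma[where S = "topspace Y - U" and T = K and a = 0 and b = 1])
         (use assms(3) closed K(2) in \<open>auto simp: disjnt_def\<close>)
    have f: "continuous_map Y euclidean f" and f01: "\<And>x. x \<in> topspace Y \<Longrightarrow> f x \<in> {0..1}"
      using f by (auto simp: continuous_map_in_subtopology)
    let ?W = "{M \<in> ProbMeas Y. (\<integral>x. f x \<partial>M) \<in> {a<..}}"
    \<comment> \<open>On \<open>topspace Y\<close>, \<open>f\<close> lies between the indicators of
      \<open>K\<close> and \<open>U\<close>. The lower bound, used only at \<open>N\<close>, puts
      \<open>N\<close> into \<open>?W\<close>; the upper bound, used at every \<open>M\<close>, puts
      \<open>?W\<close> inside \<open>?S\<close>.\<close>
    have bounds: "measure M K \<le> (\<integral>x. f x \<partial>M) \<and> (\<integral>x. f x \<partial>M) \<le> measure M U"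
      if M: "M \<in> ProbMeas Y" for M
    proof -
      interpret M: prob_space M using M by (rule ProbMeasD)
      note sp = ProbMeasD(2,3)[OF M]
      have KM: "K \<in> sets M" and UM: "U \<in> sets M"
        using sp closed assms(3) by (simp_all add: sets_borel_of_closedin sets_borel_of_openin)
      have "f \<in> borel_measurable M"
        using continuous_map_borel_measurable[OF f] measurable_cong_sets[OF sp(1) refl] by blast
      then have int: "integrable M f"
        by (rule M.integrable_const_bound[where B = 1, rotated]) (use f01 sp in auto)
      have ind: "integrable M (indicator K :: 'a \<Rightarrow> real)" "integrable M (indicator U :: 'a \<Rightarrow> real)"
        using KM UM by (simp_all add: M.emeasure_eq_measure)
      have "(\<integral>x. indicator K x \<partial>M) \<le> (\<integral>x. f x \<partial>M)"
        by (rule integral_mono) (use ind int f01 f1 sp in \<open>auto split: split_indicator\<close>)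
      moreover have "(\<integral>x. f x \<partial>M) \<le> (\<integral>x. indicator U x \<partial>M)"
        by (rule integral_mono) (use ind int f01 f0 sp in \<open>auto split: split_indicator\<close>)
      ultimately show ?thesis
        using KM UM sets.sets_into_space by (simp add: Int_absorb2)
    qed
    have "openin (vague_topology Y) ?W"
      using openin_continuous_map_preimage[OF continuous_map_vague_integral_real[OF f], of "{a<..}"]
      by simp
    moreover have "N \<in> ?W" using N K(3) bounds[of N] by auto
    moreover have "?W \<subseteq> ?S" using bounds by (fastforce simp: ev_def)
    ultimately show "\<exists>T. openin (vague_topology Y) T \<and> N \<in> T \<and> T \<subseteq> ?S" by blast
  qed
qed

text \<open>Total mass 1 turns complements into reflections; this serves both closed sets and the
  complement step of the Dynkin induction.\<close>

lemma ev_compl: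
  assumes "M \<in> ProbMeas Y" "A \<in> sets (borel_of Y)"
  shows "ev (topspace Y - A) M = 1 - ev A M"
proof -
  interpret prob_space M using assms(1) by (rule ProbMeasD)
  show ?thesis using prob_compl[of A] assms ProbMeasD[OF assms(1)] by (simp add: ev_def)
qed

lemma upper_semicontinuous_ev:
  assumes "compact_space Y" "Hausdorff_space Y" "closedin Y C"
  shows "upper_semicontinuous_map (vague_topology Y) (ev C)"
  unfolding upper_semicontinuous_map_def topspace_vague_topology
proof
  fix a :: real
  \<comment> \<open>The threshold is \<open>1 - a\<close> because \<open>M(C) < a\<close> exactly
    when the complement has mass above \<open>1 - a\<close>.\<close>
  have "openin (vague_topology Y) {M \<in> ProbMeas Y. ev (topspace Y - C) M \<in> {1 - a<..}}"
    using lower_semicontinuous_ev[OF assms(1,2), of "topspace Y - C"] assms(3)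
    by (auto simp: lower_semicontinuous_map_def)
  moreover have "{M \<in> ProbMeas Y. ev (topspace Y - C) M \<in> {1 - a<..}} =
      {M \<in> ProbMeas Y. ev C M \<in> {..<a}}"
    using ev_compl[OF _ sets_borel_of_closedin[OF assms(3)]] by auto
  ultimately show "openin (vague_topology Y) {M \<in> ProbMeas Y. ev C M \<in> {..<a}}" by simp
qed

lemma borel_measurable_ev:
  assumes "compact_space Y" "Hausdorff_space Y" "E \<in> sets (borel_of Y)"
  shows "ev E \<in> borel_measurable (borel_of (vague_topology Y))"
proof -
  let ?B = "borel_of (vague_topology Y)"
  have stable: "Int_stable {U. openin Y U}" by (auto simp: Int_stable_def)
  have Pow: "{U. openin Y U} \<subseteq> Pow (topspace Y)" by (auto dest: openin_subset)
  from assms(3)[unfolded sets_borel_of] show ?thesis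
  \<comment> \<open>Only disjoint unions need treatment in this induction, which is what lets
    countable additivity express \<open>ev\<close> of the union as a series.\<close>
  proof (induct rule: sigma_sets_induct_disjoint[OF stable Pow, consumes 1, case_names basic empty compl union])
    case (basic A)
    then show ?case
      using assms lower_semicontinuous_ev lower_semicontinuous_map_borel_measurable by blast
  next
    case empty
    then show ?case by (simp add: ev_def[abs_def])
  next
    case (compl A)
    have "(\<lambda>M. 1 - ev A M) \<in> borel_measurable ?B" using compl by simp
    moreover have "ev (topspace Y - A) M = 1 - ev A M" if "M \<in> space ?B" for M
      using that compl(1) by (intro ev_compl) (simp_all add: sets_borel_of)
    \<comment> \<open>The two functions need to agree only on \<open>space ?B\<close>, that is, on
      \<open>ProbMeas Y\<close>; elsewhere the complement formula may fail.\<close>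
    ultimately show ?case by (rule iffD2[OF measurable_cong, rotated])
  next
    case (union A)
    have "(\<lambda>M. \<Sum>i. ev (A i) M) \<in> borel_measurable ?B" using union(3) by measurable
    moreover have "ev (\<Union>i. A i) M = (\<Sum>i. ev (A i) M)" if "M \<in> space ?B" for M
    proof -
      have M: "M \<in> ProbMeas Y" using that by simp
      interpret prob_space M using M by (rule ProbMeasD)
      have "range A \<subseteq> sets M" using union(2) ProbMeasD(2)[OF M] by (auto simp: sets_borel_of)
      from finite_measure_UNION[OF this union(1)] show ?thesis by (simp add: ev_def sums_iff)
    qed
    ultimately show ?case by (rule iffD2[OF measurable_cong, rotated])
  qed
qed

theorem lemma4p64:
  fixes Y :: "'a topology" and E :: "'a set"
  assumes "compact_space Y" and "Hausdorff_space Y"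
    and "E \<in> sets (borel_of Y)"
  shows "ev E \<in> borel_measurable (borel_of (vague_topology Y))
    \<and> (openin Y E \<longrightarrow> lower_semicontinuous_map (vague_topology Y) (ev E))
    \<and> (closedin Y E \<longrightarrow> upper_semicontinuous_map (vague_topology Y) (ev E))"
  using assms borel_measurable_ev lower_semicontinuous_ev upper_semicontinuous_ev by blast

end
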